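(* Let $N$ be a positive integer, let $f,g\in R=\mathbb{Z}_N[x^{\pm},y^{\pm}]$, and suppose the $\mathbf{BB}_N(f,g)$ code is topological. Then the anyon periodicities $$l_x=\min\{\alpha\in\mathbb{Z}_{>0}\mid x^{\alpha}-1\in(f,g)_R\},\qquad l_y=\min\{\beta\in\mathbb{Z}_{>0}\mid y^{\beta}-1\in(f,g)_R\}$$ exist and are finite; that is, there exist positive integers $\alpha,\beta$ with $x^{\alpha}-1\in(f,g)_R$ and $y^{\beta}-1\in(f,g)_R$.
   Context: $\mathbb{Z}_N=\mathbb{Z}/N\mathbb{Z}$; $R=\mathbb{Z}_N[x^{\pm},y^{\pm}]$ is the Laurent polynomial ring in two variables, and $(f,g)_R$ is the ideal of $R$ generated by $f$ and $g$. For $h\in R$, $\bar h(x,y)=h(x^{-1},y^{-1})$. The $\mathbf{BB}_N(f,g)$ code (the $\mathbb{Z}_N$ qudit bivariate-bicycle code specified by $f,g\in R$) is described by the chain complex of $R$-modules $R^2\xrightarrow{\partial}R^4\xrightarrow{\varepsilon}R^2$ with $$\partial=\begin{pmatrix}\bar f&0\\ \bar g&0\\ 0&g\\ 0&-f\end{pmatrix},\qquad \varepsilon=\begin{pmatrix}0&0&f&g\\ -\bar g&\bar f&0&0\end{pmatrix}.$$ The code is called topological if $\ker\varepsilon=\operatorname{im}\partial$; equivalently, if the complex $R\xrightarrow{(g,-f)^T}R^2\xrightarrow{(f\ g)}R$ is exact at $R^2$. *)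

theory Defs
  imports
    "HOL-Library.Poly_Mapping"
    "HOL-Library.Product_Plus"
    "Berlekamp_Zassenhaus.Finite_Field"
    "Jordan_Normal_Form.Matrix"
begin

text \<open>
  The modulus is \<open>N = CARD('n)\<close> for a type variable \<open>'n\<close> of class \<open>finite\<close>, and
  \<open>'n mod_ring\<close> is the ring of integers modulo \<open>N\<close>.  The class \<open>finite\<close>, rather than
  \<open>nontriv\<close>, keeps the case \<open>N = 1\<close>.  As the zero ring is not of class \<open>comm_ring_1\<close>,
  the constant \<open>1\<close> is not available on these types, and the residue class of 1 is written
  \<open>of_int_mod_ring 1\<close>.

  A Laurent polynomial is the finitely supported family of its coefficients, indexed by the
  exponent pairs \<open>(i, j)\<close>; the product on \<open>poly_mapping\<close> is convolution.
\<close>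

type_synonym 'n laurent = "(int \<times> int) \<Rightarrow>\<^sub>0 'n mod_ring"

text \<open>\<open>lmonom i j\<close> is \<open>x\<^sup>i y\<^sup>j\<close>; in particular \<open>lmonom 0 0\<close> is the unit of the ring.\<close>

definition lmonom :: "int \<Rightarrow> int \<Rightarrow> 'n::finite laurent" where
  "lmonom i j = Poly_Mapping.single (i, j) (of_int_mod_ring 1)"

lemma lmonom_mult: "lmonom i j * lmonom k l = (lmonom (i + k) (j + l) :: 'n::finite laurent)"
proof -
  have "of_int_mod_ring 1 * of_int_mod_ring 1 = (of_int_mod_ring 1 :: 'n mod_ring)"
    by transfer (simp add: mod_simps)
  then show ?thesis
    by (simp add: lmonom_def Poly_Mapping.mult_single)
qed

lemma lmonom_0_0_mult: "lmonom 0 0 * h = (h :: 'n::finite laurent)"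
proof -
  have 1: "of_int_mod_ring 1 * c = c" for c :: "'n mod_ring"
    by transfer (auto simp add: mod_simps)
  show ?thesis
  proof (induction h rule: Poly_Mapping.update_induct)
    case const
    then show ?case by simp
  next
    case (update p a b)
    have "Poly_Mapping.update a b p = Poly_Mapping.single a b + p"
      using update(1)
      by (intro poly_mapping_eqI)
        (auto simp: lookup_update lookup_add lookup_single in_keys_iff when_def)
    moreover have "lmonom 0 0 * Poly_Mapping.single a b = Poly_Mapping.single a b"
      by (simp add: lmonom_def Poly_Mapping.mult_single 1 flip: zero_prod_def)
    ultimately show ?case
      using update(3) by (simp add: distrib_left)
  qed
qed

text \<open>\<open>bar h (x, y) = h (x\<^sup>-\<^sup>1, y\<^sup>-\<^sup>1)\<close>\<close>

definition bar :: "'n::finite laurent \<Rightarrow> 'n laurent" where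
  "bar h = Poly_Mapping.map_key uminus h"

lemma bar_lmonom: "bar (lmonom i j) = lmonom (- i) (- j)"
  using Poly_Mapping.map_key_single[of uminus "(- i, - j)"]
  by (simp add: bar_def lmonom_def)

definition ideal2 :: "'n::finite laurent \<Rightarrow> 'n laurent \<Rightarrow> 'n laurent set" where
  "ideal2 f g = {a * f + b * g | a b. True}"

lemma ideal2_least:
  fixes f g :: "'n::finite laurent"
  shows "ideal2 f g = \<Inter> {I. 0 \<in> I \<and> (\<forall>u\<in>I. \<forall>v\<in>I. u + v \<in> I) \<and> (\<forall>a. \<forall>u\<in>I. a * u \<in> I)
    \<and> f \<in> I \<and> g \<in> I}" (is "_ = \<Inter> ?S")
proof
  show "ideal2 f g \<subseteq> \<Inter> ?S"
    by (auto simp: ideal2_def)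
  have "0 \<in> ideal2 f g"
    unfolding ideal2_def by (auto intro!: exI[of _ 0])
  moreover have "f = lmonom 0 0 * f + 0 * g" "g = 0 * f + lmonom 0 0 * g"
    by (simp_all add: lmonom_0_0_mult)
  then have "f \<in> ideal2 f g" "g \<in> ideal2 f g"
    unfolding ideal2_def by blast+
  moreover have "u + v \<in> ideal2 f g" if uv: "u \<in> ideal2 f g" "v \<in> ideal2 f g" for u v
  proof -
    from uv obtain a b c d where "u = a * f + b * g" "v = c * f + d * g"
      by (auto simp: ideal2_def)
    then have "u + v = (a + c) * f + (b + d) * g"
      by (simp add: algebra_simps)
    then show ?thesis by (auto simp: ideal2_def)
  qed
  moreover have "a * u \<in> ideal2 f g" if u: "u \<in> ideal2 f g" for a u
  proof -
    from u obtain b c where "u = b * f + c * g"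
      by (auto simp: ideal2_def)
    then have "a * u = (a * b) * f + (a * c) * g"
      by (simp add: algebra_simps)
    then show ?thesis by (auto simp: ideal2_def)
  qed
  ultimately show "\<Inter> ?S \<subseteq> ideal2 f g"
    by (intro Inter_lower) simp
qed

definition BB_boundary :: "'n::finite laurent \<Rightarrow> 'n laurent \<Rightarrow> 'n laurent mat" where
  "BB_boundary f g = mat_of_rows_list 2
     [[bar f, 0],
      [bar g, 0],
      [0,     g],
      [0,   - f]]"

definition BB_syndrome :: "'n::finite laurent \<Rightarrow> 'n laurent \<Rightarrow> 'n laurent mat" where
  "BB_syndrome f g = mat_of_rows_list 4
     [[0,       0,     f, g],
      [- bar g, bar f, 0, 0]]"

text \<open>
  Elements of the free modules are column vectors.  The library's \<open>mat_kernel\<close> is restricted to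
  \<open>comm_ring_1\<close>, which would exclude \<open>N = 1\<close>, so the kernel is written out.
\<close>

definition BB_topological :: "'n::finite laurent \<Rightarrow> 'n laurent \<Rightarrow> bool" where
  "BB_topological f g \<longleftrightarrow>
     {v \<in> carrier_vec 4. BB_syndrome f g *\<^sub>v v = 0\<^sub>v 2} = (\<lambda>w. BB_boundary f g *\<^sub>v w) ` carrier_vec 2"

lemma BB_topological_iff:
  fixes f g :: "'n::finite laurent"
  shows "BB_topological f g \<longleftrightarrow>
     (\<forall>a b c d. (f * c + g * d = 0 \<and> - bar g * a + bar f * b = 0) \<longleftrightarrow>
        (\<exists>s t. a = bar f * s \<and> b = bar g * s \<and> c = g * t \<and> d = - f * t))"
proof -
  have eq: "vec_of_list [a, b, c, d] = vec_of_list [a', b', c', d'] \<longleftrightarrow>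
      a = a' \<and> b = b' \<and> c = c' \<and> d = d'" for a b c d a' b' c' d' :: "'n laurent"
    by (metis list.inject list_vec)
  have ex4: "\<exists>a b c d. v = vec_of_list [a, b, c, d]" if "v \<in> carrier_vec 4" for v :: "'n laurent vec"
  proof (intro exI)
    show "v = vec_of_list [v $ 0, v $ 1, v $ 2, v $ 3]"
      using that by (intro eq_vecI)
        (auto simp: vec_of_list_index numeral_eq_Suc less_Suc_eq)
  qed
  have ex2: "\<exists>s t. v = vec_of_list [s, t]" if "v \<in> carrier_vec 2" for v :: "'n laurent vec"
  proof (intro exI)
    show "v = vec_of_list [v $ 0, v $ 1]"
      using that by (intro eq_vecI)
        (auto simp: vec_of_list_index numeral_eq_Suc less_Suc_eq)
  qed
  have carr: "vec_of_list [a, b, c, d] \<in> carrier_vec 4" "vec_of_list [a, b] \<in> carrier_vec 2"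
    for a b c d :: "'n laurent"
    by (rule carrier_vecI, simp)+
  have syn': "BB_syndrome f g *\<^sub>v vec_of_list [a, b, c, d] =
      vec_of_list [f * c + g * d, - bar g * a + bar f * b]" for a b c d
    by (rule eq_vecI) (auto simp: BB_syndrome_def mat_of_rows_list_def scalar_prod_def
        vec_of_list_index numeral_eq_Suc less_Suc_eq)
  have "vec_of_list [p, q] = 0\<^sub>v 2 \<longleftrightarrow> p = 0 \<and> q = 0" for p q :: "'n laurent"
  proof -
    have "0\<^sub>v 2 = vec_of_list [0, 0 :: 'n laurent]"
      by (rule eq_vecI) (auto simp: vec_of_list_index numeral_eq_Suc less_Suc_eq)
    then show ?thesis
      by (metis list.inject list_vec)
  qed
  then have syn: "BB_syndrome f g *\<^sub>v vec_of_list [a, b, c, d] = 0\<^sub>v 2 \<longleftrightarrow>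
      f * c + g * d = 0 \<and> - bar g * a + bar f * b = 0" for a b c d
    using syn' by metis
  have bnd: "BB_boundary f g *\<^sub>v vec_of_list [s, t] =
      vec_of_list [bar f * s, bar g * s, g * t, - f * t]" for s t
    by (rule eq_vecI) (auto simp: BB_boundary_def mat_of_rows_list_def scalar_prod_def
        vec_of_list_index numeral_eq_Suc less_Suc_eq)
  have img: "vec_of_list [a, b, c, d] \<in> (\<lambda>w. BB_boundary f g *\<^sub>v w) ` carrier_vec 2 \<longleftrightarrow>
      (\<exists>s t. a = bar f * s \<and> b = bar g * s \<and> c = g * t \<and> d = - f * t)" for a b c d
  proof
    assume "vec_of_list [a, b, c, d] \<in> (\<lambda>w. BB_boundary f g *\<^sub>v w) ` carrier_vec 2"
    then obtain s t where
      "vec_of_list [a, b, c, d] = BB_boundary f g *\<^sub>v vec_of_list [s, t]"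
      using ex2 by blast
    then show "\<exists>s t. a = bar f * s \<and> b = bar g * s \<and> c = g * t \<and> d = - f * t"
      unfolding bnd eq by blast
  next
    assume "\<exists>s t. a = bar f * s \<and> b = bar g * s \<and> c = g * t \<and> d = - f * t"
    then show "vec_of_list [a, b, c, d] \<in> (\<lambda>w. BB_boundary f g *\<^sub>v w) ` carrier_vec 2"
      using bnd carr(2) by (metis image_eqI)
  qed
  have sub: "(\<lambda>w. BB_boundary f g *\<^sub>v w) ` carrier_vec 2 \<subseteq> carrier_vec 4"
  proof (rule image_subsetI)
    fix w :: "'n laurent vec"
    show "BB_boundary f g *\<^sub>v w \<in> carrier_vec 4"
      by (rule carrier_vecI) (simp add: BB_boundary_def mat_of_rows_list_def)
  qed
  have "BB_topological f g \<longleftrightarrow>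
      (\<forall>v\<in>carrier_vec 4. BB_syndrome f g *\<^sub>v v = 0\<^sub>v 2 \<longleftrightarrow>
        v \<in> (\<lambda>w. BB_boundary f g *\<^sub>v w) ` carrier_vec 2)"
    unfolding BB_topological_def using sub by blast
  also have "\<dots> \<longleftrightarrow>
      (\<forall>a b c d. BB_syndrome f g *\<^sub>v vec_of_list [a, b, c, d] = 0\<^sub>v 2 \<longleftrightarrow>
        vec_of_list [a, b, c, d] \<in> (\<lambda>w. BB_boundary f g *\<^sub>v w) ` carrier_vec 2)"
  proof (rule iffI; intro allI ballI)
    fix v :: "'n laurent vec"
    assume *: "\<forall>a b c d. BB_syndrome f g *\<^sub>v vec_of_list [a, b, c, d] = 0\<^sub>v 2 \<longleftrightarrow>
        vec_of_list [a, b, c, d] \<in> (\<lambda>w. BB_boundary f g *\<^sub>v w) ` carrier_vec 2"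
      and "v \<in> carrier_vec 4"
    from ex4[OF this(2)] obtain a b c d where v: "v = vec_of_list [a, b, c, d]"
      by blast
    show "BB_syndrome f g *\<^sub>v v = 0\<^sub>v 2 \<longleftrightarrow> v \<in> (\<lambda>w. BB_boundary f g *\<^sub>v w) ` carrier_vec 2"
      unfolding v by (rule *[rule_format])
  next
    fix a b c d
    assume *: "\<forall>v\<in>carrier_vec 4. BB_syndrome f g *\<^sub>v v = 0\<^sub>v 2 \<longleftrightarrow>
        v \<in> (\<lambda>w. BB_boundary f g *\<^sub>v w) ` carrier_vec 2"
    show "BB_syndrome f g *\<^sub>v vec_of_list [a, b, c, d] = 0\<^sub>v 2 \<longleftrightarrow>
        vec_of_list [a, b, c, d] \<in> (\<lambda>w. BB_boundary f g *\<^sub>v w) ` carrier_vec 2"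
      by (rule bspec[OF * carr(1)])
  qed
  finally show ?thesis
    unfolding syn img .
qed

definition is_anyon_period_x :: "'n::finite laurent \<Rightarrow> 'n laurent \<Rightarrow> nat \<Rightarrow> bool" where
  "is_anyon_period_x f g l \<longleftrightarrow>
     0 < l \<and> lmonom (int l) 0 - lmonom 0 0 \<in> ideal2 f g \<and>
     (\<forall>\<alpha>. 0 < \<alpha> \<and> lmonom (int \<alpha>) 0 - lmonom 0 0 \<in> ideal2 f g \<longrightarrow> l \<le> \<alpha>)"

definition is_anyon_period_y :: "'n::finite laurent \<Rightarrow> 'n laurent \<Rightarrow> nat \<Rightarrow> bool" where
  "is_anyon_period_y f g l \<longleftrightarrow>
     0 < l \<and> lmonom 0 (int l) - lmonom 0 0 \<in> ideal2 f g \<and>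
     (\<forall>\<beta>. 0 < \<beta> \<and> lmonom 0 (int \<beta>) - lmonom 0 0 \<in> ideal2 f g \<longrightarrow> l \<le> \<beta>)"

end

theory Submission
  imports Defs
begin

text \<open>
  Clearing denominators, \<open>f\<close> and \<open>g\<close> become \<open>F, G \<in> \<int>[x][y]\<close>, with exactness holding modulo \<open>N\<close>
  and up to powers of \<open>w = xy\<close>. Iterating exactness on a relation \<open>(N / p) F = 0\<close> makes \<open>N / p\<close>
  divisible by every power of \<open>G\<close>, so no prime \<open>p\<close> dividing \<open>N\<close> divides both \<open>F\<close> and \<open>G\<close>;
  hence \<open>F\<close> and \<open>G\<close> have no common annihilator modulo \<open>N\<close>. Pseudo-division in \<open>y\<close> modulo \<open>p\<close>
  produces \<open>h \<in> (F, G)\<close> and \<open>u \<in> \<int>[x]\<close>, nonzero modulo \<open>p\<close>, such that \<open>h\<close> divides \<open>u F\<close> and \<open>u G\<close>.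
  The resulting syzygy is a multiple of the Koszul one, so \<open>h\<close> divides \<open>w\<^sup>k u\<close>, and \<open>u\<close> lies in
  \<open>(p, f, g)\<close>. Replacing \<open>u\<close> by a monic polynomial and multiplying over the primes dividing \<open>N\<close>
  gives a monic polynomial in \<open>x\<close> in \<open>(f, g)\<close>; modulo it and \<open>N\<close> two powers of the unit \<open>x\<close> agree.
\<close>

subsection \<open>Exactness of the Koszul complex modulo \<open>N\<close>\<close>

text \<open>Otherwise \<open>p\<close> and \<open>m\<close> are coprime integers, and a Bezout
  relation between them makes \<open>of_nat p\<close> a unit.\<close>

lemma prime_elem_of_nat_dvd_of_nat:
  assumes "prime_elem (of_nat p :: 'a::idom)" "prime p" "of_nat p dvd (of_nat m :: 'a)"
  shows "p dvd m"
proof (rule ccontr)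
  assume "\<not> p dvd m"
  then have "coprime (int p) (int m)"
    using \<open>prime p\<close> by (simp add: prime_imp_coprime)
  then obtain a b where "a * int p + b * int m = 1"
    using bezout_int[of "int p" "int m"] by (auto simp: coprime_iff_gcd_eq_1)
  then have "of_int a * of_nat p + of_int b * of_nat m = (1 :: 'a)"
    by (metis of_int_1 of_int_add of_int_mult of_int_of_nat_eq)
  then have "of_nat p dvd (1 :: 'a)"
    using assms(3) by (metis dvd_add dvd_mult dvd_triv_right)
  then show False
    using assms(1) by (simp add: prime_elem_def)
qed

text \<open>
  The powers of \<open>w\<close> in the exactness hypothesis account for passing from a
  localization, where \<open>w\<close> is a unit, to the ring itself.
\<close>

locale koszul_exact_mod =
  fixes F G w :: "'a::{idom,ring_char_0}" and N :: nat
  assumes N_pos: "N > 0"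
    and exact: "of_nat N dvd F * c + G * d \<Longrightarrow>
      \<exists>k t. of_nat N dvd w ^ k * c - G * t \<and> of_nat N dvd w ^ k * d + F * t"
    and prime_elem_of_nat: "prime p \<Longrightarrow> p dvd N \<Longrightarrow> prime_elem (of_nat p :: 'a)"
    and not_dvd_w: "prime p \<Longrightarrow> p dvd N \<Longrightarrow> \<not> of_nat p dvd w"
begin

text \<open>If \<open>e\<close> annihilates \<open>F\<close> modulo \<open>N\<close>, then
  \<open>(e, 0)\<close> is a syzygy, so exactness makes \<open>e\<close> a multiple of
  \<open>G\<close>, up to a power of \<open>w\<close>. The cofactor annihilates \<open>F\<close>
  again, which allows iteration.\<close>

lemma annihilator_divisible:
  assumes "of_nat N dvd M * F"
  shows "\<exists>k e. of_nat N dvd w ^ k * M - e * G ^ n \<and> of_nat N dvd e * F"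
proof (induction n)
  case 0
  show ?case
    by (rule exI[of _ 0], rule exI[of _ M]) (use assms in simp)
next
  case (Suc n)
  then obtain k e where e: "of_nat N dvd w ^ k * M - e * G ^ n" "of_nat N dvd e * F"
    by blast
  then obtain l t where t: "of_nat N dvd w ^ l * e - G * t" "of_nat N dvd F * t"
    using exact[of e 0] by (auto simp: mult.commute)
  have "w ^ (l + k) * M - t * G ^ Suc n
      = w ^ l * (w ^ k * M - e * G ^ n) + G ^ n * (w ^ l * e - G * t)"
    by (simp add: algebra_simps power_add)
  then have "of_nat N dvd w ^ (l + k) * M - t * G ^ Suc n"
    using e(1) t(1) by (metis dvd_add dvd_mult)
  then show ?case
    using t(2) by (metis mult.commute)
qed

lemma not_both_divisible:
  assumes p: "prime p" "p dvd N"
  shows "\<not> (of_nat p dvd F \<and> of_nat p dvd G)"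
proof
  assume dvd: "of_nat p dvd F \<and> of_nat p dvd G"
  obtain m where m: "N = p ^ multiplicity p N * m" "\<not> p dvd m"
    using multiplicity_decompose'[of N p] N_pos p(1) by (auto dest: prime_gt_Suc_0_nat)
  define e where "e = multiplicity p N - 1"
  have "multiplicity p N > 0"
    using N_pos p by (simp add: prime_multiplicity_gt_zero_iff)
  then have N: "N = p ^ Suc e * m"
    using m(1) by (simp add: e_def)
  let ?P = "of_nat p :: 'a"
  have P: "prime_elem ?P" "?P \<noteq> 0"
    using prime_elem_of_nat[OF p] prime_gt_0_nat[OF p(1)] by auto
  have N': "of_nat N = ?P ^ e * (?P * of_nat m)"
    by (simp add: N algebra_simps)
  \<comment> \<open>The annihilator is \<open>N / p = p ^ e * m\<close>: it kills \<open>F\<close>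
    modulo \<open>N\<close> because \<open>p\<close> divides \<open>F\<close>.\<close>
  have "of_nat N dvd (?P ^ e * of_nat m) * F"
    using dvd unfolding N' by (auto simp: algebra_simps)
  then obtain k t where t: "of_nat N dvd w ^ k * (?P ^ e * of_nat m) - t * G ^ Suc e"
    using annihilator_divisible by blast
  \<comment> \<open>Since \<open>p\<close> divides \<open>G\<close>, the term
    \<open>t * G ^ Suc e\<close> vanishes modulo \<open>p ^ Suc e\<close>. What remains is
    \<open>w ^ k * p ^ e * m\<close>, in which \<open>p\<close> occurs only \<open>e\<close>
    times.\<close>
  have "?P ^ Suc e dvd of_nat N"
    by (simp add: N)
  moreover have "?P ^ Suc e dvd t * G ^ Suc e"
    using dvd by (intro dvd_mult dvd_power_same) simp
  ultimately have "?P ^ Suc e dvd (w ^ k * (?P ^ e * of_nat m) - t * G ^ Suc e) + t * G ^ Suc e"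
    using t by (meson dvd_add dvd_trans)
  then have "?P ^ e * ?P dvd ?P ^ e * (w ^ k * of_nat m)"
    by (simp add: algebra_simps)
  then have "?P dvd w ^ k * of_nat m"
    using P(2) by simp
  then have "?P dvd of_nat m"
    using P(1) not_dvd_w[OF p] by (meson prime_elem_dvd_multD prime_elem_dvd_power)
  then show False
    using prime_elem_of_nat_dvd_of_nat[OF P(1) p(1)] m(2) by blast
qed

lemma prime_dvd_annihilator:
  assumes p: "prime p" "p dvd N" and "of_nat p dvd d * F" "of_nat p dvd d * G"
  shows "of_nat p dvd d"
  using assms not_both_divisible[OF p] prime_elem_of_nat[OF p] by (meson prime_elem_dvd_multD)

text \<open>The prime factors of \<open>n\<close> are peeled off one at a time: \<open>p\<close>
  divides \<open>d\<close> by the prime case, and cancelling it leaves the same hypotheses for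
  \<open>n / p\<close>.\<close>

lemma dvd_annihilator:
  assumes "n dvd N" "of_nat n dvd d * F" "of_nat n dvd d * G"
  shows "of_nat n dvd d"
  using assms
proof (induction n arbitrary: d rule: less_induct)
  case (less n)
  show ?case
  proof (cases "n = 1")
    case False
    then obtain p m where p: "prime p" and n: "n = p * m"
      by (meson dvd_def prime_factor_nat)
    have pN: "p dvd N"
      using less.prems(1) n by auto
    have "of_nat p dvd d * F" "of_nat p dvd d * G"
      using less.prems(2,3) n by (auto intro: dvd_mult_left)
    then obtain d' where d': "d = of_nat p * d'"
      using prime_dvd_annihilator[OF p pN] by blast
    have "(of_nat p :: 'a) \<noteq> 0"
      using p by auto
    then have "of_nat m dvd d' * F" "of_nat m dvd d' * G"
      using less.prems(2,3) by (auto simp: n d' mult.assoc)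
    moreover have "m < n"
      using less.prems(1) N_pos p by (auto simp: n prime_gt_Suc_0_nat intro: Nat.gr0I)
    moreover have "m dvd N"
      using less.prems(1) n by auto
    ultimately have "of_nat m dvd d'"
      using less.IH by blast
    then show ?thesis
      by (simp add: n d')
  qed simp
qed

text \<open>
  If \<open>F\<close> and \<open>G\<close> are multiples of \<open>h\<close> modulo \<open>p\<close>, up to the factor \<open>u\<close>, then the cofactors
  yield the syzygy \<open>((N / p) G', - (N / p) F')\<close>; by exactness it is a multiple of \<open>(G, - F)\<close>,
  which forces \<open>h\<close> to divide \<open>w ^ k * u\<close>.
\<close>

lemma common_divisor_dvd:
  assumes p: "prime p" "p dvd N" and u: "\<not> of_nat p dvd u"
    and F': "of_nat p dvd u * F - F' * h" and G': "of_nat p dvd u * G - G' * h"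
  shows "\<exists>k s. of_nat p dvd w ^ k * u - s * h"
proof -
  let ?P = "of_nat p :: 'a"
  have P: "prime_elem ?P" "?P \<noteq> 0"
    using prime_elem_of_nat[OF p] prime_gt_0_nat[OF p(1)] by auto
  obtain M where N: "N = p * M"
    using p(2) by blast
  have M: "(of_nat M :: 'a) \<noteq> 0"
    using N_pos N by auto
  \<comment> \<open>Eliminating \<open>h\<close> from the two congruences and cancelling
    \<open>u\<close> gives a Koszul-type relation modulo \<open>p\<close>.\<close>
  have "u * (F' * G - G' * F) = F' * (u * G - G' * h) - G' * (u * F - F' * h)"
    by (simp add: algebra_simps)
  then have "?P dvd u * (F' * G - G' * F)"
    using F' G' by (metis dvd_diff dvd_mult)
  then have "?P dvd F' * G - G' * F"
    using P(1) u by (meson prime_elem_dvd_multD)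
  \<comment> \<open>Multiplication by \<open>M = N / p\<close> turns a relation modulo
    \<open>p\<close> into one modulo \<open>N\<close>, where exactness applies.\<close>
  then have "of_nat N dvd of_nat M * (F' * G - G' * F)"
    by (simp add: N mult.commute mult_dvd_mono)
  moreover have "of_nat M * (F' * G - G' * F) = - (F * (of_nat M * G') + G * - (of_nat M * F'))"
    by (simp add: algebra_simps)
  ultimately have "of_nat N dvd F * (of_nat M * G') + G * - (of_nat M * F')"
    by (metis dvd_minus_iff)
  then obtain k t where t: "of_nat N dvd w ^ k * (of_nat M * G') - G * t"
      "of_nat N dvd w ^ k * - (of_nat M * F') + F * t"
    using exact by blast
  \<comment> \<open>Modulo \<open>M\<close> the cofactor terms vanish, so \<open>t\<close>
    annihilates both \<open>F\<close> and \<open>G\<close>. Hence \<open>M\<close> divides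
    \<open>t\<close> and can be cancelled from the syzygy.\<close>
  have MN: "of_nat M dvd (of_nat N :: 'a)"
    by (simp add: N)
  have "of_nat M dvd w ^ k * (of_nat M * G') - (w ^ k * (of_nat M * G') - G * t)"
    by (rule dvd_diff[OF _ dvd_trans[OF MN t(1)]]) simp
  moreover have "of_nat M dvd (w ^ k * - (of_nat M * F') + F * t) + w ^ k * (of_nat M * F')"
    by (rule dvd_add[OF dvd_trans[OF MN t(2)]]) simp
  ultimately have "of_nat M dvd t * G" "of_nat M dvd t * F"
    by (simp_all add: mult.commute)
  then have "of_nat M dvd t"
    using dvd_annihilator[of M t] N by simp
  then obtain s where s: "t = of_nat M * s" by blast
  have "of_nat M * ?P dvd of_nat M * (w ^ k * G' - G * s)"
    using t(1) by (simp add: N s algebra_simps)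
  then have G: "?P dvd w ^ k * G' - G * s"
    using M by simp
  have "of_nat M * ?P dvd of_nat M * - (w ^ k * F' - F * s)"
    using t(2) by (simp add: N s algebra_simps)
  then have F: "?P dvd w ^ k * F' - F * s"
    using M by (metis dvd_minus_iff dvd_mult_cancel_left)
  \<comment> \<open>The difference \<open>w ^ k * u - s * h\<close> annihilates \<open>F\<close> and
    \<open>G\<close> modulo \<open>p\<close>, hence is itself divisible by \<open>p\<close>.\<close>
  have "(w ^ k * u - s * h) * F = w ^ k * (u * F - F' * h) + h * (w ^ k * F' - F * s)"
    by (simp add: algebra_simps)
  then have "?P dvd (w ^ k * u - s * h) * F"
    using F F' by (metis dvd_add dvd_mult)
  moreover have "(w ^ k * u - s * h) * G = w ^ k * (u * G - G' * h) + h * (w ^ k * G' - G * s)"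
    by (simp add: algebra_simps)
  then have "?P dvd (w ^ k * u - s * h) * G"
    using G G' by (metis dvd_add dvd_mult)
  ultimately show ?thesis
    using prime_dvd_annihilator[OF p] by blast
qed

end

subsection \<open>Monic polynomials in the ideal\<close>

text \<open>The length of the coefficient list serves as the measure in the inductions below. Unlike
  the degree, it still drops when a nonzero constant becomes zero.\<close>

lemma length_coeffs_le:
  assumes "\<And>n. n \<ge> d \<Longrightarrow> coeff P n = 0"
  shows "length (coeffs P) \<le> d"
proof (cases "P = 0")
  case False
  then show ?thesis
    using assms[of "degree P"] by (simp add: length_coeffs_degree not_le[symmetric] Suc_le_eq)
      (metis leading_coeff_0_iff not_le)
qed simp

text \<open>This is the Euclidean algorithm over the fraction field of the coefficient ring modulo
  \<open>p\<close>, with denominators collected in \<open>u\<close>. The common divisor is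
  \<open>a * F + b * G\<close>.\<close>

lemma common_divisor_mod_prime:
  fixes p :: "'a::idom" and F G :: "'a poly"
  assumes p: "prime_elem p"
  shows "\<exists>u a b F' G'. \<not> p dvd u \<and> [:p:] dvd [:u:] * F - F' * (a * F + b * G)
    \<and> [:p:] dvd [:u:] * G - G' * (a * F + b * G)"
    (is "?P F G")
proof (induction "length (coeffs F) + length (coeffs G)" arbitrary: F G rule: less_induct)
  case less
  have not_unit: "\<not> p dvd 1"
    using p prime_elem_def by blast
  have swap: "?P F G" if "?P G F" for F G
    using that by (metis add.commute)
  \<comment> \<open>Changing \<open>F\<close> by a multiple of \<open>p\<close> preserves the
    multiplier, both coefficients and both cofactors.\<close>
  have cong: "?P F G" if "?P E G" and d: "[:p:] dvd F - E" for E F G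
  proof -
    from \<open>?P E G\<close> obtain u a b E' G' where u: "\<not> p dvd u"
      and E': "[:p:] dvd [:u:] * E - E' * (a * E + b * G)"
      and G': "[:p:] dvd [:u:] * G - G' * (a * E + b * G)" by blast
    have "[:u:] * F - E' * (a * F + b * G)
        = ([:u:] * E - E' * (a * E + b * G)) + (F - E) * ([:u:] - E' * a)"
      by (simp add: algebra_simps del: mult_pCons_left mult_pCons_right)
    then have "[:p:] dvd [:u:] * F - E' * (a * F + b * G)"
      using E' d by (metis dvd_add dvd_mult2)
    moreover have "[:u:] * G - G' * (a * F + b * G)
        = ([:u:] * G - G' * (a * E + b * G)) - (F - E) * (G' * a)"
      by (simp add: algebra_simps del: mult_pCons_left mult_pCons_right)
    then have "[:p:] dvd [:u:] * G - G' * (a * F + b * G)"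
      using G' d by (metis dvd_diff dvd_mult2)
    ultimately show ?thesis using u by blast
  qed
  have strip: "?P F G"
    if IH: "\<And>E. length (coeffs E) < length (coeffs F) \<Longrightarrow> ?P E G"
      and "F \<noteq> 0" and "p dvd lead_coeff F" for F G
  proof (rule cong)
    let ?E = "F - monom (lead_coeff F) (degree F)"
    have "length (coeffs ?E) \<le> degree F"
      by (rule length_coeffs_le) (auto simp: coeff_eq_0 le_less)
    then show "?P ?E G"
      using \<open>F \<noteq> 0\<close> by (intro IH) (simp add: length_coeffs_degree)
    show "[:p:] dvd F - ?E"
      using \<open>p dvd lead_coeff F\<close> by (simp add: const_poly_dvd_iff)
  qed
  have reduce: "?P F G"
    if IH: "\<And>E. length (coeffs E) < length (coeffs G) \<Longrightarrow> ?P F E"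
      and "G \<noteq> 0" and le: "degree F \<le> degree G" and lc: "\<not> p dvd lead_coeff F" for F G
  proof -
    \<comment> \<open>One pseudo-division step: \<open>m\<close> is chosen so that the terms of
      degree \<open>degree G\<close> cancel in \<open>E\<close>.\<close>
    define m where "m = monom (lead_coeff G) (degree G - degree F)"
    define E where "E = [:lead_coeff F:] * G - m * F"
    have "length (coeffs E) \<le> degree G"
    proof (rule length_coeffs_le)
      fix n assume "degree G \<le> n"
      then show "coeff E n = 0"
        using le by (cases "n = degree G")
          (auto simp: E_def m_def coeff_monom_mult coeff_eq_0)
    qed
    then have "?P F E"
      using \<open>G \<noteq> 0\<close> by (intro IH) (simp add: length_coeffs_degree)
    then obtain u a b F' G' where u: "\<not> p dvd u"
      and F': "[:p:] dvd [:u:] * F - F' * (a * F + b * E)"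
      and G': "[:p:] dvd [:u:] * E - G' * (a * F + b * E)" by blast
    define l where "l = [:lead_coeff F:]"
    \<comment> \<open>The combination found for \<open>(F, E)\<close> is also one of
      \<open>F\<close> and \<open>G\<close>. Recovering \<open>l * G = E + m * F\<close> costs the
      factor \<open>lead_coeff F\<close>, which enters the multiplier; primality of \<open>p\<close>
      keeps the product nonzero modulo \<open>p\<close>.\<close>
    have h: "a * F + b * E = (a - b * m) * F + (b * l) * G"
      by (simp add: E_def l_def algebra_simps)
    have c: "[:u * lead_coeff F:] = [:u:] * l"
      by (simp add: l_def mult.commute)
    have "\<not> p dvd u * lead_coeff F"
      using u lc p by (simp add: prime_elem_dvd_mult_iff)
    moreover have "[:u * lead_coeff F:] * F - (l * F') * ((a - b * m) * F + (b * l) * G)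
        = l * ([:u:] * F - F' * (a * F + b * E))"
      unfolding h c by (simp add: algebra_simps del: mult_pCons_left mult_pCons_right)
    then have "[:p:] dvd [:u * lead_coeff F:] * F - (l * F') * ((a - b * m) * F + (b * l) * G)"
      using F' by (metis dvd_mult)
    moreover have "[:u * lead_coeff F:] * G - (G' + m * F') * ((a - b * m) * F + (b * l) * G)
        = ([:u:] * E - G' * (a * F + b * E)) + m * ([:u:] * F - F' * (a * F + b * E))"
      unfolding h[symmetric] c
      by (simp add: E_def l_def[symmetric] algebra_simps del: mult_pCons_left mult_pCons_right)
    then have "[:p:] dvd [:u * lead_coeff F:] * G - (G' + m * F') * ((a - b * m) * F + (b * l) * G)"
      using F' G' by (metis dvd_add dvd_mult)
    ultimately show ?thesis by blast
  qed
  have IH1: "?P E G" if "length (coeffs E) < length (coeffs F)" for E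
    by (rule less) (use that in simp)
  have IH2: "?P F E" if "length (coeffs E) < length (coeffs G)" for E
    by (rule less) (use that in simp)
  have zero: "?P 0 G" for G
    by (rule exI[of _ 1], rule exI[of _ 0], rule exI[of _ 1], rule exI[of _ 0], rule exI[of _ 1])
      (use not_unit in simp)
  show ?case
  proof (cases "F = 0 \<or> G = 0")
    case True
    then show ?thesis using zero swap by metis
  next
    case False
    consider "p dvd lead_coeff F" | "p dvd lead_coeff G"
      | "\<not> p dvd lead_coeff F" "degree F \<le> degree G"
      | "\<not> p dvd lead_coeff G" "degree G \<le> degree F"
      by linarith
    then show ?thesis
    proof cases
      case 1
      then show ?thesis
        using False by - (rule strip, erule IH1, auto)
    next
      case 2
      then show ?thesis
        using False by - (rule swap, rule strip, rule swap, erule IH2, auto)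
    next
      case 3
      then show ?thesis
        using False by - (rule reduce, erule IH2, auto)
    next
      case 4
      then show ?thesis
        using False by - (rule swap, rule reduce, rule swap, erule IH1, auto)
    qed
  qed
qed

text \<open>A leading term divisible by \<open>p\<close> is discarded; once the leading coefficient
  is prime to \<open>p\<close>, it is inverted modulo \<open>p\<close>.\<close>

lemma monic_mod_prime:
  fixes u :: "int poly"
  assumes p: "prime p" and u: "\<not> of_nat p dvd u"
  shows "\<exists>U v r. lead_coeff U = 1 \<and> U = v * u + of_nat p * r"
  using u
proof (induction "length (coeffs u)" arbitrary: u rule: less_induct)
  case (less u)
  then have "u \<noteq> 0" by auto
  show ?case
  proof (cases "int p dvd lead_coeff u")
    case True
    define m where "m = monom (lead_coeff u) (degree u)"
    have "of_nat p dvd m"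
      using True by (simp add: m_def of_nat_poly const_poly_dvd_iff)
    then obtain r where r: "m = of_nat p * r" by blast
    have "length (coeffs (u - m)) \<le> degree u"
      by (rule length_coeffs_le) (auto simp: m_def coeff_eq_0 le_less)
    then have "length (coeffs (u - m)) < length (coeffs u)"
      using \<open>u \<noteq> 0\<close> by (simp add: length_coeffs_degree)
    moreover have "\<not> of_nat p dvd u - m"
      using less.prems r by (metis diff_add_cancel dvd_add dvd_triv_left)
    ultimately obtain U v s where "lead_coeff U = 1" "U = v * (u - m) + of_nat p * s"
      using less.hyps by blast
    moreover from this(2) have "U = v * u + of_nat p * (s - v * r)"
      by (simp add: r algebra_simps)
    ultimately show ?thesis by blast
  next
    case False
    then have "coprime (int p) (lead_coeff u)"
      using p by (intro prime_imp_coprime) auto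
    then obtain a b where ab: "a * int p + b * lead_coeff u = 1"
      using bezout_int[of "int p" "lead_coeff u"] by (auto simp: coprime_iff_gcd_eq_1)
    \<comment> \<open>The Bezout term \<open>p * a\<close> corrects the leading coefficient to be
      exactly 1 as an integer, not only modulo \<open>p\<close>.\<close>
    define U where "U = [:b:] * u + of_nat p * monom a (degree u)"
    have c: "coeff U n = b * coeff u n + int p * coeff (monom a (degree u)) n" for n
      by (simp add: U_def of_nat_poly)
    have "degree U \<le> degree u"
      by (rule degree_le) (auto simp: c coeff_eq_0)
    moreover have "coeff U (degree u) = 1"
      using ab by (simp add: c algebra_simps)
    ultimately have "lead_coeff U = 1"
      by (metis le_antisym le_degree zero_neq_one)
    then show ?thesis
      using U_def by blast
  qed
qed

text \<open>The quotient of \<open>\<int>[t]\<close> by \<open>N\<close> and a monic polynomial is finite, so two powers of \<open>t\<close> agree.\<close>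

lemma powers_collide_mod_monic:
  fixes U :: "int poly"
  assumes U: "lead_coeff U = 1" and N: "N > 0"
  shows "\<exists>i j q r. i < j \<and> monom 1 j - monom 1 i = U * q + of_nat N * r"
proof -
  define S where "S = Poly ` {xs. set xs \<subseteq> {0..<int N} \<and> length xs \<le> Suc (degree U)}"
  \<comment> \<open>Remainders have bounded degree, and reducing their coefficients modulo
    \<open>N\<close> leaves finitely many values.\<close>
  define rem where "rem P = map_poly (\<lambda>c. c mod int N) (pseudo_mod P U)" for P
  have "U \<noteq> 0"
    using U by auto
  have "rem P \<in> S" for P
  proof -
    have "length (coeffs (rem P)) \<le> Suc (degree U)"
    proof (rule length_coeffs_le)
      fix n assume "Suc (degree U) \<le> n"
      then have "coeff (pseudo_mod P U) n = 0"
        using pseudo_mod(2)[OF \<open>U \<noteq> 0\<close>, of P] by (auto intro: coeff_eq_0)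
      then show "coeff (rem P) n = 0"
        by (simp add: rem_def coeff_map_poly)
    qed
    moreover have "c \<in> {0..<int N}" if "c \<in> set (coeffs (rem P))" for c
    proof -
      have "c \<in> range (coeff (rem P))"
        using that by (auto simp: range_coeff)
      then show ?thesis
        using N by (auto simp: rem_def coeff_map_poly)
    qed
    ultimately show ?thesis
      unfolding S_def by (intro image_eqI[of _ _ "coeffs (rem P)"]) auto
  qed
  moreover have "finite S"
    unfolding S_def by (intro finite_imageI finite_lists_length_le) simp
  ultimately have "finite (range (\<lambda>i. rem (monom 1 i)))"
    by (meson finite_subset image_subset_iff)
  then have "\<not> inj (\<lambda>i::nat. rem (monom 1 i))"
    using range_inj_infinite by blast
  then obtain i j where ij: "i < j" "rem (monom 1 i) = rem (monom 1 j)"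
    unfolding inj_on_def by (metis linorder_neqE_nat)
  \<comment> \<open>Since \<open>U\<close> is monic, the multiplier in pseudo-division is 1, so this
    is genuine division.\<close>
  have "\<exists>q. P = U * q + pseudo_mod P U" for P
    using pseudo_divmod(1)[OF \<open>U \<noteq> 0\<close>, of P "fst (pseudo_divmod P U)" "pseudo_mod P U"] U
    by (auto simp: pseudo_mod_def)
  then obtain q where q: "\<And>P. P = U * q P + pseudo_mod P U"
    by metis
  have "of_nat N dvd pseudo_mod (monom 1 j) U - pseudo_mod (monom 1 i) U"
  proof -
    have "coeff (rem (monom 1 j)) n = coeff (rem (monom 1 i)) n" for n
      by (simp add: ij)
    then show ?thesis
      by (simp add: of_nat_poly const_poly_dvd_iff rem_def coeff_map_poly mod_eq_dvd_iff)
  qed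
  then obtain r where r: "pseudo_mod (monom 1 j) U - pseudo_mod (monom 1 i) U = of_nat N * r"
    by blast
  have "monom 1 j - monom 1 i = U * (q (monom 1 j) - q (monom 1 i)) + of_nat N * r"
    unfolding r[symmetric] right_diff_distrib using q[of "monom 1 i"] q[of "monom 1 j"]
    by (metis add_diff_add)
  then show ?thesis
    using ij(1) by blast
qed

section \<open>Passage from the prime divisors of \<open>N\<close> to \<open>N\<close> in
  Z[x][y]\<close>

lemma prime_elem_of_nat_poly_poly:
  "prime p \<Longrightarrow> prime_elem (of_nat p :: int poly poly)"
  by (simp add: of_nat_poly prime_elem_const_poly_iff)

text \<open>The inner polynomial variable is x and the outer one y, so
  \<open>monom (monom 1 1) 1\<close> is xy, and \<open>[:U:]\<close> is a polynomial in x
  alone.\<close>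

locale koszul_exact_mod_poly =
  fixes F G :: "int poly poly" and N :: nat
  assumes N_pos: "N > 0"
    and exact: "of_nat N dvd F * c + G * d \<Longrightarrow>
      \<exists>k t. of_nat N dvd monom (monom 1 1) 1 ^ k * c - G * t
        \<and> of_nat N dvd monom (monom 1 1) 1 ^ k * d + F * t"
begin

abbreviation w :: "int poly poly" where "w \<equiv> monom (monom 1 1) 1"

sublocale koszul_exact_mod F G w N
proof
  show "\<not> of_nat p dvd w" if "prime p" for p :: nat
  proof
    assume "of_nat p dvd w"
    then have "int p dvd coeff (coeff w 1) 1"
      unfolding of_nat_poly const_poly_dvd_iff by blast
    then show False
      using that by simp
  qed
qed (use N_pos exact prime_elem_of_nat_poly_poly in auto)

text \<open>Pseudo-division in y gives a common divisor \<open>a * F + b * G\<close> with multiplier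
  \<open>u\<close> in Z[x]. By exactness it divides \<open>w ^ k * u\<close> modulo
  \<open>p\<close>, and a multiple of \<open>u\<close> is monic modulo \<open>p\<close>.\<close>

lemma monic_mod_prime_in_ideal:
  assumes p: "prime p" "p dvd N"
  shows "\<exists>U k a b c. lead_coeff U = 1 \<and> w ^ k * [:U:] = a * F + b * G + of_nat p * c"
proof -
  have "prime_elem (of_nat p :: int poly)"
    using p(1) by (simp add: of_nat_poly prime_elem_const_poly_iff)
  then obtain u a b F' G' where u: "\<not> of_nat p dvd u"
    and "[:of_nat p:] dvd [:u:] * F - F' * (a * F + b * G)"
    and "[:of_nat p:] dvd [:u:] * G - G' * (a * F + b * G)"
    using common_divisor_mod_prime by blast
  moreover have "\<not> of_nat p dvd [:u:]"
    using u unfolding of_nat_poly[where 'a = "int poly"] by simp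
  ultimately obtain k s where "of_nat p dvd w ^ k * [:u:] - s * (a * F + b * G)"
    using common_divisor_dvd[OF p] unfolding of_nat_poly[where 'a = "int poly", symmetric] by blast
  then obtain c where "w ^ k * [:u:] - s * (a * F + b * G) = of_nat p * c" by blast
  then have c: "w ^ k * [:u:] = s * (a * F + b * G) + of_nat p * c"
    by (simp add: algebra_simps)
  obtain U v r where U: "lead_coeff U = 1" "U = v * u + of_nat p * r"
    using monic_mod_prime[OF p(1) u] by blast
  have "[:U:] = [:v:] * [:u:] + of_nat p * [:r:]"
    by (simp add: U(2) of_nat_poly)
  then have "w ^ k * [:U:] = [:v:] * (w ^ k * [:u:]) + of_nat p * (w ^ k * [:r:])"
    by (simp only: algebra_simps)
  also have "\<dots> = ([:v:] * s * a) * F + ([:v:] * s * b) * G + of_nat p * ([:v:] * c + w ^ k * [:r:])"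
    unfolding c by (simp only: algebra_simps)
  finally show ?thesis
    using U(1) by blast
qed

text \<open>Relations for \<open>m\<close> and for \<open>p\<close> are multiplied: the error terms
  combine to a multiple of \<open>p * m\<close>, every other term lies in the ideal of
  \<open>F\<close> and \<open>G\<close>, and the product of monic polynomials is monic.\<close>

lemma monic_in_ideal:
  assumes "n dvd N"
  shows "\<exists>U k a b c. lead_coeff U = 1 \<and> w ^ k * [:U:] = a * F + b * G + of_nat n * c"
  using assms
proof (induction n rule: less_induct)
  case (less n)
  show ?case
  proof (cases "n = 1")
    case True
    then show ?thesis
      by (intro exI[of _ 1] exI[of _ 0]) auto
  next
    case False
    then obtain p m where p: "prime p" and n: "n = p * m"
      by (meson dvd_def prime_factor_nat)
    have pN: "p dvd N" and mN: "m dvd N"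
      using less.prems n by auto
    have "m < n"
      using less.prems N_pos p by (auto simp: n prime_gt_Suc_0_nat intro: Nat.gr0I)
    then obtain U k a b c where 1: "lead_coeff U = 1"
        "w ^ k * [:U:] = a * F + b * G + of_nat m * c"
      using less.IH mN by blast
    obtain V l a' b' c' where 2: "lead_coeff V = 1"
        "w ^ l * [:V:] = a' * F + b' * G + of_nat p * c'"
      using monic_mod_prime_in_ideal[OF p pN] by blast
    have "w ^ (k + l) * [:U * V:] = (w ^ k * [:U:]) * (w ^ l * [:V:])"
      by (simp add: power_add mult_ac)
    also have "\<dots> = (a * (w ^ l * [:V:]) + of_nat m * c * a') * F
        + (b * (w ^ l * [:V:]) + of_nat m * c * b') * G + of_nat n * (c * c')"
      unfolding 1(2) unfolding 2(2) n of_nat_mult by (simp only: algebra_simps)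
    finally show ?thesis
      using 1(1) 2(1) by (metis lead_coeff_mult mult_1)
  qed
qed

lemma powers_collide:
  "\<exists>i j k a b c. i < j \<and> w ^ k * ([:monom 1 j:] - [:monom 1 i:]) = a * F + b * G + of_nat N * c"
proof -
  obtain U k a b c where U: "lead_coeff U = 1"
      "w ^ k * [:U:] = a * F + b * G + of_nat N * c"
    using monic_in_ideal[OF dvd_refl] by blast
  obtain i j q r where ij: "i < j" "monom 1 j - monom 1 i = U * q + of_nat N * r"
    using powers_collide_mod_monic[OF U(1) N_pos] by blast
  have "[:monom 1 j:] - [:monom 1 i:] = [:U:] * [:q:] + of_nat N * [:r:]"
    by (simp add: ij(2) of_nat_poly)
  then have "w ^ k * ([:monom 1 j:] - [:monom 1 i:])
      = [:q:] * (w ^ k * [:U:]) + of_nat N * (w ^ k * [:r:])"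
    by (simp only: algebra_simps)
  also have "\<dots> = ([:q:] * a) * F + ([:q:] * b) * G + of_nat N * ([:q:] * c + w ^ k * [:r:])"
    unfolding U(2) by (simp only: algebra_simps)
  finally show ?thesis
    using ij(1) by blast
qed

end

subsection \<open>Laurent polynomials as a localization\<close>

text \<open>Horner evaluation with coefficients sent through \<open>h\<close>. The target is only a
  \<open>comm_ring\<close>, so that modulus 1 is covered; using it twice evaluates polynomials in
  two variables.\<close>

definition eval_via :: "('a::zero \<Rightarrow> 'b::comm_ring) \<Rightarrow> 'b \<Rightarrow> 'a poly \<Rightarrow> 'b" where
  "eval_via h x P = fold_coeffs (\<lambda>a s. h a + x * s) P 0"

lemma eval_via_0 [simp]: "eval_via h x 0 = 0"
  by (simp add: eval_via_def)

lemma eval_via_pCons: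
  "h 0 = 0 \<Longrightarrow> eval_via h x (pCons a P) = h a + x * eval_via h x P"
  by (cases "a = 0 \<and> P = 0") (auto simp: eval_via_def)

lemma eval_via_add:
  fixes h :: "'a::comm_ring \<Rightarrow> 'b::comm_ring"
  assumes add: "\<And>a b. h (a + b) = h a + h b"
  shows "eval_via h x (P + Q) = eval_via h x P + eval_via h x Q"
proof -
  have 0: "h 0 = 0"
    using add[of 0 0] by simp
  show ?thesis
    by (induction P Q rule: poly_induct2) (simp_all add: eval_via_pCons 0 add algebra_simps)
qed

lemma eval_via_mult:
  fixes h :: "'a::comm_ring \<Rightarrow> 'b::comm_ring"
  assumes add: "\<And>a b. h (a + b) = h a + h b" and mult: "\<And>a b. h (a * b) = h a * h b"
  shows "eval_via h x (P * Q) = eval_via h x P * eval_via h x Q"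
proof -
  have 0: "h 0 = 0"
    using add[of 0 0] by simp
  have smult: "eval_via h x (smult a Q) = h a * eval_via h x Q" for a
    by (induction Q) (simp_all add: eval_via_pCons 0 mult algebra_simps)
  show ?thesis
    by (induction P) (simp_all add: eval_via_pCons eval_via_add[OF add] smult 0 algebra_simps)
qed

lemma of_int_mod_ring_add:
  "of_int_mod_ring (a + b) = (of_int_mod_ring a + of_int_mod_ring b :: 'n::finite mod_ring)"
  by transfer (simp add: mod_simps)

lemma of_int_mod_ring_mult:
  "of_int_mod_ring (a * b) = (of_int_mod_ring a * of_int_mod_ring b :: 'n::finite mod_ring)"
  by transfer (simp add: mod_simps)

lemma of_int_mod_ring_eq_0_iff:
  "of_int_mod_ring a = (0 :: 'n::finite mod_ring) \<longleftrightarrow> int CARD('n) dvd a"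
  by transfer (simp add: mod_eq_0_iff_dvd)

lemma of_int_mod_ring_1_mult: "of_int_mod_ring 1 * c = (c :: 'n::finite mod_ring)"
  by (metis mult_1 of_int_mod_ring_mult of_int_mod_ring_to_int_mod_ring)

lemma poly_mapping_additive_induct [case_names zero single add]:
  fixes p :: "'a \<Rightarrow>\<^sub>0 'b::comm_monoid_add"
  assumes "P 0" and "\<And>k v. P (Poly_Mapping.single k v)"
    and "\<And>p q. P p \<Longrightarrow> P q \<Longrightarrow> P (p + q)"
  shows "P p"
proof (induction p rule: Poly_Mapping.update_induct)
  case (update p a b)
  then have "Poly_Mapping.update a b p = Poly_Mapping.single a b + p"
    by (intro poly_mapping_eqI)
      (auto simp: lookup_update lookup_add lookup_single in_keys_iff when_def)
  then show ?case
    using assms update by simp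
qed (use assms in simp)

lemma lookup_lmonom_mult:
  "Poly_Mapping.lookup (lmonom i j * h) (k, l) = Poly_Mapping.lookup h (k - i, l - j)"
proof (induction h rule: poly_mapping_additive_induct)
  case (single m v)
  then show ?case
    by (cases m)
      (auto simp: lmonom_def mult_single of_int_mod_ring_1_mult lookup_single when_def)
qed (simp_all add: distrib_left lookup_add)

lemma lmonom_mult_eq_0:
  assumes "lmonom i j * h = 0"
  shows "h = 0"
proof -
  have "lmonom (- i) (- j) * (lmonom i j * h) = h"
    by (simp add: lmonom_mult lmonom_0_0_mult flip: mult.assoc)
  then show ?thesis
    using assms by simp
qed

text \<open>The canonical homomorphism from Z[x][y] to the Laurent ring: reduce coefficients modulo
  \<open>N\<close>, then invert xy.\<close>

definition laurent_of_poly :: "int poly poly \<Rightarrow> 'n::finite laurent" where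
  "laurent_of_poly =
    eval_via (eval_via (\<lambda>n. Poly_Mapping.single 0 (of_int_mod_ring n)) (lmonom 1 0)) (lmonom 0 1)"

lemma laurent_of_poly_add: "laurent_of_poly (P + Q) = laurent_of_poly P + laurent_of_poly Q"
  unfolding laurent_of_poly_def
  by (intro eval_via_add) (simp add: of_int_mod_ring_add single_add)

lemma laurent_of_poly_mult: "laurent_of_poly (P * Q) = laurent_of_poly P * laurent_of_poly Q"
  unfolding laurent_of_poly_def
  by (intro eval_via_mult eval_via_add)
    (simp_all add: of_int_mod_ring_add of_int_mod_ring_mult single_add mult_single)

lemma laurent_of_poly_diff: "laurent_of_poly (P - Q) = laurent_of_poly P - laurent_of_poly Q"
  by (metis add_diff_cancel diff_add_cancel laurent_of_poly_add)

lemma lookup_laurent_of_poly: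
  "Poly_Mapping.lookup (laurent_of_poly P :: 'n::finite laurent) (i, j) =
    (if 0 \<le> i \<and> 0 \<le> j then of_int_mod_ring (coeff (coeff P (nat j)) (nat i)) else 0)"
proof -
  let ?c = "\<lambda>n. Poly_Mapping.single (0, 0) (of_int_mod_ring n) :: 'n laurent"
  have c0: "?c 0 = 0" by simp
  have 1: "Poly_Mapping.lookup (eval_via ?c (lmonom 1 0) q) (i, j) =
      (if 0 \<le> i \<and> j = 0 then of_int_mod_ring (coeff q (nat i)) else 0)" for q i j
  proof (induction q arbitrary: i)
    case (pCons a q)
    have "nat i = Suc (nat (i - 1))" if "0 < i"
      using that by simp
    then show ?case
      by (auto simp: eval_via_pCons[of ?c, OF c0] lookup_add lookup_lmonom_mult pCons.IH
          lookup_single when_def coeff_pCons split: nat.splits)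
  qed simp
  show ?thesis
    unfolding laurent_of_poly_def zero_prod_def
  proof (induction P arbitrary: j)
    case (pCons a P)
    have "nat j = Suc (nat (j - 1))" if "0 < j"
      using that by simp
    then show ?case
      by (auto simp: eval_via_pCons lookup_add lookup_lmonom_mult pCons.IH 1
          coeff_pCons split: nat.splits)
  qed simp
qed

text \<open>Distinct exponents stay distinct, so vanishing is tested coefficientwise. This
  translates equations of Laurent polynomials into congruences modulo \<open>N\<close> and
  back.\<close>

lemma laurent_of_poly_eq_0_iff:
  "laurent_of_poly P = (0 :: 'n::finite laurent) \<longleftrightarrow> of_nat CARD('n) dvd P"
proof -
  have "laurent_of_poly P = (0 :: 'n laurent) \<longleftrightarrow>
      (\<forall>i j. of_int_mod_ring (coeff (coeff P j) i) = (0 :: 'n mod_ring))"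
  proof
    assume *: "laurent_of_poly P = (0 :: 'n laurent)"
    show "\<forall>i j. of_int_mod_ring (coeff (coeff P j) i) = (0 :: 'n mod_ring)"
    proof (intro allI)
      fix i j
      show "of_int_mod_ring (coeff (coeff P j) i) = (0 :: 'n mod_ring)"
        using lookup_laurent_of_poly[of P "int i" "int j", where 'n = 'n] * by simp
    qed
  next
    assume "\<forall>i j. of_int_mod_ring (coeff (coeff P j) i) = (0 :: 'n mod_ring)"
    then show "laurent_of_poly P = (0 :: 'n laurent)"
      by (intro poly_mapping_eqI) (auto simp: lookup_laurent_of_poly)
  qed
  also have "\<dots> \<longleftrightarrow> of_nat CARD('n) dvd P"
    by (simp add: of_int_mod_ring_eq_0_iff of_nat_poly const_poly_dvd_iff) blast
  finally show ?thesis .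
qed

lemma laurent_of_poly_monom:
  "laurent_of_poly (monom (monom a i) j) =
    Poly_Mapping.single (int i, int j) (of_int_mod_ring a)"
proof (rule poly_mapping_eqI)
  fix m :: "int \<times> int"
  obtain k l where m: "m = (k, l)" by fastforce
  show "Poly_Mapping.lookup (laurent_of_poly (monom (monom a i) j)) m =
      Poly_Mapping.lookup (Poly_Mapping.single (int i, int j) (of_int_mod_ring a)) m"
    by (cases "j = nat l"; cases "i = nat k")
      (auto simp: m lookup_laurent_of_poly lookup_single when_def)
qed

lemma laurent_of_poly_monom_power: "laurent_of_poly (monom (monom 1 1) 1 ^ k) = lmonom (int k) (int k)"
  by (simp add: monom_power laurent_of_poly_monom lmonom_def)

lemma ex_laurent_of_poly: "\<exists>k P. lmonom (int k) (int k) * h = laurent_of_poly P"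
proof (induction h rule: poly_mapping_additive_induct)
  case zero
  then show ?case
    by (intro exI[of _ 0]) (simp add: laurent_of_poly_def)
next
  case (single m v)
  obtain i j where m: "m = (i, j)" by fastforce
  \<comment> \<open>The power \<open>k\<close> is large enough to make both exponents
    nonnegative.\<close>
  define k where "k = nat \<bar>i\<bar> + nat \<bar>j\<bar>"
  have "0 \<le> int k + i" "0 \<le> int k + j"
    by (simp_all add: k_def)
  then have "lmonom (int k) (int k) * Poly_Mapping.single m v
      = laurent_of_poly (monom (monom (to_int_mod_ring v) (nat (int k + i))) (nat (int k + j)))"
    by (simp add: m lmonom_def mult_single of_int_mod_ring_1_mult laurent_of_poly_monom)
  then show ?case by blast
next
  case (add p q)
  then obtain k P l Q where P: "lmonom (int k) (int k) * p = laurent_of_poly P"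
      and Q: "lmonom (int l) (int l) * q = laurent_of_poly Q" by blast
  let ?w = "monom (monom 1 1) 1 :: int poly poly"
  have "lmonom (int (k + l)) (int (k + l)) * (p + q)
      = lmonom (int l) (int l) * (lmonom (int k) (int k) * p)
      + lmonom (int k) (int k) * (lmonom (int l) (int l) * q)"
    by (simp add: distrib_left lmonom_mult add.commute flip: mult.assoc)
  also have "\<dots> = laurent_of_poly (?w ^ l * P + ?w ^ k * Q)"
    unfolding P Q laurent_of_poly_add laurent_of_poly_mult laurent_of_poly_monom_power ..
  finally show ?case by blast
qed

section \<open>Exchange of the two variables\<close>

definition swap_vars :: "'n::finite laurent \<Rightarrow> 'n laurent" where
  "swap_vars h = Poly_Mapping.map_key prod.swap h"

lemma swap_vars_0 [simp]: "swap_vars 0 = 0"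
  by (simp add: swap_vars_def)

lemma swap_vars_single:
  "swap_vars (Poly_Mapping.single (i, j) v) = Poly_Mapping.single (j, i) v"
  using Poly_Mapping.map_key_single[of prod.swap "(j, i)" v] by (simp add: swap_vars_def)

lemma swap_vars_add: "swap_vars (p + q) = swap_vars p + swap_vars q"
  by (simp add: swap_vars_def map_key_plus)

lemma swap_vars_swap_vars [simp]: "swap_vars (swap_vars p) = p"
  by (rule poly_mapping_eqI) (simp add: swap_vars_def map_key.rep_eq)

lemma swap_vars_mult: "swap_vars (p * q) = swap_vars p * swap_vars q"
proof (induction p rule: poly_mapping_additive_induct)
  case (single k v)
  show ?case
  proof (induction q rule: poly_mapping_additive_induct)
    case (single l v')
    then show ?case
      by (cases k; cases l) (simp add: mult_single swap_vars_single)
  qed (simp_all add: distrib_left swap_vars_add)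
qed (simp_all add: distrib_right swap_vars_add)

lemma swap_vars_lmonom: "swap_vars (lmonom i j) = lmonom j i"
  by (simp add: lmonom_def swap_vars_single)

lemma swap_vars_uminus: "swap_vars (- p) = - swap_vars p"
  by (rule minus_unique[symmetric]) (simp flip: swap_vars_add)

lemma swap_vars_diff: "swap_vars (p - q) = swap_vars p - swap_vars q"
  using swap_vars_add[of p "- q"] by (simp add: swap_vars_uminus)

section \<open>Existence of the periods\<close>

lemma ex_x_period:
  fixes f g :: "'n::finite laurent"
  assumes exact: "\<And>c d. f * c + g * d = 0 \<Longrightarrow> \<exists>t. c = g * t \<and> d = - f * t"
  shows "\<exists>\<alpha>>0. lmonom (int \<alpha>) 0 - lmonom 0 0 \<in> ideal2 f g"
proof -
  let ?w = "monom (monom 1 1) 1 :: int poly poly"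
  let ?W = "\<lambda>k. lmonom (int k) (int k) :: 'n laurent"
  let ?\<Phi> = "laurent_of_poly :: int poly poly \<Rightarrow> 'n laurent"
  have W_add: "?W (k + l) = ?W k * ?W l" for k l
    by (simp add: lmonom_mult)
  obtain k\<^sub>1 P where P: "?W k\<^sub>1 * f = ?\<Phi> P"
    using ex_laurent_of_poly by blast
  obtain k\<^sub>2 Q where Q: "?W k\<^sub>2 * g = ?\<Phi> Q"
    using ex_laurent_of_poly by blast
  \<comment> \<open>A common power of xy is used for \<open>f\<close> and \<open>g\<close>, so that
    a syzygy of \<open>F\<close> and \<open>G\<close> is a unit times one of \<open>f\<close> and
    \<open>g\<close>.\<close>
  define k where "k = k\<^sub>1 + k\<^sub>2"
  define F where "F = ?w ^ k\<^sub>2 * P"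
  define G where "G = ?w ^ k\<^sub>1 * Q"
  have F: "?\<Phi> F = ?W k * f"
    by (simp only: F_def k_def laurent_of_poly_mult laurent_of_poly_monom_power
        P[symmetric] W_add mult_ac)
  have G: "?\<Phi> G = ?W k * g"
    by (simp only: G_def k_def laurent_of_poly_mult laurent_of_poly_monom_power
        Q[symmetric] W_add mult_ac)
  interpret koszul_exact_mod_poly F G "CARD('n)"
  proof
    fix c d
    assume "of_nat CARD('n) dvd F * c + G * d"
    then have "?\<Phi> (F * c + G * d) = 0"
      by (simp only: laurent_of_poly_eq_0_iff)
    then have "?W k * (f * ?\<Phi> c + g * ?\<Phi> d) = 0"
      by (simp only: laurent_of_poly_add laurent_of_poly_mult F G distrib_left mult.assoc)
    then obtain t where t: "?\<Phi> c = g * t" "?\<Phi> d = - f * t"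
      using exact lmonom_mult_eq_0 by blast
    \<comment> \<open>The witness \<open>t\<close> may have negative exponents: \<open>l\<close>
      powers of xy clear them, and \<open>k\<close> more account for the factor between
      \<open>G\<close> and \<open>g\<close>, or \<open>F\<close> and \<open>f\<close>.\<close>
    obtain l T where T: "?W l * t = ?\<Phi> T"
      using ex_laurent_of_poly by blast
    have "?\<Phi> (?w ^ (k + l) * c - G * T) = 0"
      by (simp only: laurent_of_poly_diff laurent_of_poly_mult laurent_of_poly_monom_power
          W_add G t T[symmetric]) (simp add: mult_ac)
    moreover have "?\<Phi> (?w ^ (k + l) * d + F * T) = 0"
      by (simp only: laurent_of_poly_add laurent_of_poly_mult laurent_of_poly_monom_power
          W_add F t T[symmetric]) (simp add: mult_ac)
    ultimately show "\<exists>k t. of_nat CARD('n) dvd ?w ^ k * c - G * t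
        \<and> of_nat CARD('n) dvd ?w ^ k * d + F * t"
      unfolding laurent_of_poly_eq_0_iff by blast
  qed simp
  obtain i j m a b c where ij: "i < j"
    and eq: "?w ^ m * ([:monom 1 j:] - [:monom 1 i:]) = a * F + b * G + of_nat CARD('n) * c"
    using powers_collide by blast
  have "?\<Phi> (of_nat CARD('n) * c) = 0"
    by (simp only: laurent_of_poly_eq_0_iff dvd_triv_left)
  moreover have "?\<Phi> [:monom 1 n:] = lmonom (int n) 0" for n
    using laurent_of_poly_monom[of 1 n 0] by (simp add: monom_0 lmonom_def)
  ultimately have "?W m * (lmonom (int j) 0 - lmonom (int i) 0)
      = ?\<Phi> a * (?W k * f) + ?\<Phi> b * (?W k * g)"
    using arg_cong[OF eq, of ?\<Phi>]
    by (simp only: laurent_of_poly_diff laurent_of_poly_add laurent_of_poly_mult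
        laurent_of_poly_monom_power F G add_0_right)
  \<comment> \<open>The new factor is the inverse of the monomial \<open>w ^ m\<close> times the
    \<open>i\<close>-th power of x, which turns the difference of two powers into the required
    form.\<close>
  then have "lmonom (- int m - int i) (- int m) * (?W m * (lmonom (int j) 0 - lmonom (int i) 0))
      = lmonom (- int m - int i) (- int m) * (?\<Phi> a * (?W k * f) + ?\<Phi> b * (?W k * g))"
    by (rule arg_cong)
  then have "lmonom (int (j - i)) 0 - lmonom 0 0
      = lmonom (- int m - int i) (- int m) * ?W k * ?\<Phi> a * f
      + lmonom (- int m - int i) (- int m) * ?W k * ?\<Phi> b * g"
    using ij by (simp add: right_diff_distrib distrib_left lmonom_mult mult_ac of_nat_diff
        flip: mult.assoc)
  then have "lmonom (int (j - i)) 0 - lmonom 0 0 \<in> ideal2 f g"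
    unfolding ideal2_def by blast
  then show ?thesis
    using ij by (intro exI[of _ "j - i"]) simp
qed

text \<open>Exactness is invariant under exchanging x and y, so an x-period of the swapped pair
  becomes a y-period of \<open>f\<close> and \<open>g\<close>.\<close>

lemma ex_y_period:
  fixes f g :: "'n::finite laurent"
  assumes exact: "\<And>c d. f * c + g * d = 0 \<Longrightarrow> \<exists>t. c = g * t \<and> d = - f * t"
  shows "\<exists>\<beta>>0. lmonom 0 (int \<beta>) - lmonom 0 0 \<in> ideal2 f g"
proof -
  have "\<exists>t. c = swap_vars g * t \<and> d = - swap_vars f * t"
    if "swap_vars f * c + swap_vars g * d = 0" for c d
  proof -
    have "swap_vars (swap_vars f * c + swap_vars g * d) = 0"
      by (simp add: that)
    then have "f * swap_vars c + g * swap_vars d = 0"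
      by (simp add: swap_vars_add swap_vars_mult)
    then obtain t where "swap_vars c = g * t" "swap_vars d = - f * t"
      using exact by blast
    then have "c = swap_vars (g * t)" "d = swap_vars (- f * t)"
      by (metis swap_vars_swap_vars)+
    then show ?thesis
      by (auto simp: swap_vars_mult swap_vars_uminus)
  qed
  then obtain \<beta> a b where "\<beta> > 0"
      and "lmonom (int \<beta>) 0 - lmonom 0 0 = a * swap_vars f + b * swap_vars g"
    using ex_x_period[of "swap_vars f" "swap_vars g"] by (auto simp: ideal2_def)
  from this(2) have "swap_vars (lmonom (int \<beta>) 0 - lmonom 0 0)
      = swap_vars (a * swap_vars f + b * swap_vars g)"
    by (rule arg_cong)
  then have "lmonom 0 (int \<beta>) - lmonom 0 0 = swap_vars a * f + swap_vars b * g"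
    by (simp add: swap_vars_add swap_vars_diff swap_vars_mult swap_vars_lmonom)
  then show ?thesis
    using \<open>\<beta> > 0\<close> unfolding ideal2_def by blast
qed

theorem mainTheorem4:
  fixes f g :: "'n::finite laurent"
  assumes "BB_topological f g"
  shows "(\<exists>\<alpha>>0. lmonom (int \<alpha>) 0 - lmonom 0 0 \<in> ideal2 f g) \<and>
         (\<exists>\<beta>>0. lmonom 0 (int \<beta>) - lmonom 0 0 \<in> ideal2 f g) \<and>
         (\<exists>l\<^sub>x. is_anyon_period_x f g l\<^sub>x) \<and>
         (\<exists>l\<^sub>y. is_anyon_period_y f g l\<^sub>y)"
proof -
  have "\<exists>t. c = g * t \<and> d = - f * t" if "f * c + g * d = 0" for c d
  proof -
    \<comment> \<open>Zero in the first two components isolates the half of the complex that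
      involves \<open>f\<close> and \<open>g\<close> without \<open>bar\<close>.\<close>
    have "f * c + g * d = 0 \<and> - bar g * 0 + bar f * 0 = 0"
      using that by simp
    then show ?thesis
      using assms unfolding BB_topological_iff by blast
  qed
  then have x: "\<exists>\<alpha>>0. lmonom (int \<alpha>) 0 - lmonom 0 0 \<in> ideal2 f g"
      and y: "\<exists>\<beta>>0. lmonom 0 (int \<beta>) - lmonom 0 0 \<in> ideal2 f g"
    by (rule ex_x_period ex_y_period, blast)+
  have "\<exists>l. is_anyon_period_x f g l"
    using exists_least_iff[THEN iffD1, OF x] unfolding is_anyon_period_x_def
    by (meson not_le)
  moreover have "\<exists>l. is_anyon_period_y f g l"
    using exists_least_iff[THEN iffD1, OF y] unfolding is_anyon_period_y_def
    by (meson not_le)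
  ultimately show ?thesis
    using x y by blast
qed

end
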